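(* Let $p,q\in(0,\infty)$ with $p\neq q$ and let $T$ be an infinite rooted tree such that the sequence $\{c_n\}$ is unbounded. Then there are no invertible multiplication operators from $\mathbb{T}_p$ to $\mathbb{T}_q$; that is, there is no $\psi:T\to\mathbb{C}$ such that $M_\psi:\mathbb{T}_p\to\mathbb{T}_q$ is an invertible operator.
   Context: Let $T$ be an infinite rooted tree with root $o$; $T$ also denotes its vertex set. For a vertex $v$, $|v|$ is the number of edges in the unique path from $o$ to $v$. For $n\in\mathbb{N}_0=\{0,1,2,\dots\}$, $D_n=\{v\in T:|v|=n\}$, and $c_n$ is the number of elements of $D_n$, assumed finite for each $n$ (so $1\le c_n<\infty$). For $f:T\to\mathbb{C}$ and $0<p<\infty$ put $M_p(n,f)=\left(\frac1{c_n}\sum_{|v|=n}|f(v)|^p\right)^{1/p}$, $\|f\|_p=\sup_{n\in\mathbb{N}_0}M_p(n,f)$ and $\mathbb{T}_p=\{f:T\to\mathbb{C}:\|f\|_p<\infty\}$. For $\psi:T\to\mathbb{C}$, $M_\psi f=\psi f$ (pointwise product). A linear operator $A:X\to Y$ is bounded if $\sup\{\|Af\|_Y/\|f\|_X: f\in X, f\neq0\}<\infty$; $M_\psi:X\to Y$ is invertible if it maps $X$ into $Y$, is bounded, and there is a bounded linear operator $B:Y\to X$ with $BM_\psi=I_X$ and $M_\psi B=I_Y$. *)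

theory Defs
  imports "HOL-Analysis.Analysis" "Graph_Theory.Graph_Theory"
begin

text \<open>
  Undirected simple graphs are symmetric loopfree digraphs, possibly infinite. A single undirected
  edge then yields directed cycles of length 2, so the undirected cycles are those of length at
  least 3. (For the same reason \<^const>\<open>Digraph_Component.tree\<close> cannot be used here.)
\<close>

locale rooted_tree = pair_bidirected_digraph T
  for T :: "'v pair_pre_digraph" +
  fixes r :: 'v
  assumes connected: "Digraph_Component.connected (with_proj T)"
    and acyclic: "cycle p \<Longrightarrow> length p < 3"
    and root_in_verts: "r \<in> pverts T"

text \<open>
  Existence and uniqueness of paths, so that \<open>depth\<close> below is well defined.
\<close>

lemma (in rooted_tree) apath_unique:
  assumes "apath u p v" "apath u q v"
  shows "p = q"
  using assms
proof (induction p arbitrary: u q)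
  case Nil
  then have "u = v" by (simp add: apath_Nil_iff)
  with Nil.prems(2) show ?case
    using apath_nonempty_ends by blast
next
  case (Cons e p)
  have ne: "u \<noteq> v"
    using Cons.prems(1) apath_nonempty_ends by blast
  then obtain f q' where q: "q = f # q'"
    using Cons.prems(2) by (cases q) (auto simp: apath_Nil_iff)
  show ?case
  proof (cases "e = f")
    case True
    then show ?thesis
      using Cons.prems Cons.IH q by (auto simp: apath_Cons_iff)
  next
    case False
    let ?a = "snd e" and ?b = "snd f"
    have e: "e \<in> parcs T" "fst e = u" "apath ?a p v" "u \<notin> set (awalk_verts ?a p)"
      and f: "f \<in> parcs T" "fst f = u" "apath ?b q' v" "u \<notin> set (awalk_verts ?b q')"
      using Cons.prems unfolding q by (auto simp: apath_Cons_iff)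
    have end_in: "v \<in> set (awalk_verts w s)" if "awalk w s v" for w s
    proof -
      have "last (awalk_verts w s) = v"
        using that by (rule awalkE')
      then show ?thesis
        using last_in_set[OF awalk_verts_non_Nil[of w s]] by simp
    qed
    have ex: "\<exists>x\<in>set (awalk_verts ?a p). x \<in> set (awalk_verts ?b q')"
      using end_in e(3) f(3) by (meson apath_def)
    obtain xs x ys where x: "awalk_verts ?a p = xs @ x # ys"
        "x \<in> set (awalk_verts ?b q')" "\<forall>y\<in>set xs. y \<notin> set (awalk_verts ?b q')"
      using split_list_first_prop[OF ex] by blast
    then obtain xs' ys' where x': "awalk_verts ?b q' = xs' @ x # ys'"
      by (meson split_list)
    have casp: "cas ?a p v" and casq: "cas ?b q' v"
      using e(3) f(3) by (auto simp: apath_def)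
    obtain p1 p2 where p1: "cas ?a p1 x" "p = p1 @ p2" "awalk_verts ?a p1 = xs @ [x]"
      using awalk_decomp_verts[OF casp x(1)] by metis
    obtain q1 q2 where q1: "cas ?b q1 x" "q' = q1 @ q2" "awalk_verts ?b q1 = xs' @ [x]"
      using awalk_decomp_verts[OF casq x'] by metis
    have w1: "awalk u (e # p1) x"
      using e p1 by (auto simp: apath_def awalk_Cons_iff awalk_def)
    have w2: "awalk u (f # q1) x"
      using f q1 by (auto simp: apath_def awalk_Cons_iff awalk_def)
    let ?c = "(e # p1) @ rev_path (f # q1)"
    have w: "awalk u ?c u"
      by (rule awalk_appendI[OF w1]) (use w2 in \<open>simp only: awalk_rev_path\<close>)
    have rev: "awalk_verts x (rev_path (f # q1)) = rev (awalk_verts u (f # q1))"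
      by (rule awalk_verts_rev_path[OF w2])
    have last: "last (awalk_verts u (e # p1)) = x"
      using w1 by (rule awalkE')
    have v1: "awalk_verts u (e # p1) = u # xs @ [x]"
      using e(2) p1(3) by simp
    have v2: "awalk_verts u (f # q1) = u # xs' @ [x]"
      using f(2) q1(3) by simp
    have "awalk_verts u ?c = (u # xs @ [x]) @ tl (rev (u # xs' @ [x]))"
      using awalk_verts_append[OF w] last unfolding v1 by (simp only: rev v2)
    then have "tl (awalk_verts u ?c) = tl ((u # xs @ [x]) @ tl (rev (u # xs' @ [x])))"
      by (rule arg_cong)
    also have "\<dots> = xs @ x # rev xs' @ [u]"
      by simp
    finally have verts: "tl (awalk_verts u ?c) = xs @ x # rev xs' @ [u]" .
    have "distinct (xs @ x # ys)" "distinct (xs' @ x # ys')"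
      using e(3) f(3) x(1) x' by (auto simp: apath_def)
    moreover have "u \<notin> set (xs @ [x])" "u \<notin> set xs'" "set xs \<inter> set xs' = {}"
      using e(4) f(4) x(3) unfolding x(1) x' by auto
    ultimately have "distinct (tl (awalk_verts u ?c))"
      unfolding verts by auto
    with w have "cycle ?c"
      unfolding cycle_def by blast
    then have "length ?c < 3"
      by (rule acyclic)
    then have "p1 = []" "q1 = []"
      by auto
    then have "?a = ?b"
      using p1(1) q1(1) by auto
    with e(2) f(2) False show ?thesis
      by (simp add: prod_eq_iff)
  qed
qed

lemma (in rooted_tree) ex1_apath:
  assumes "v \<in> pverts T"
  shows "\<exists>!p. apath r p v"
proof -
  have "strongly_connected (with_proj T)"
    using symmetric_connected_imp_strongly_connected[OF sym_arcs connected] .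
  then have "r \<rightarrow>\<^sup>*\<^bsub>with_proj T\<^esub> v"
    using assms root_in_verts by (auto simp: strongly_connected_def)
  then obtain p where p: "apath r p v"
    by (auto simp: reachable_apath)
  show ?thesis
    by (intro ex1I[where a = p]) (simp_all add: p apath_unique[OF _ p])
qed

definition depth :: "'v pair_pre_digraph \<Rightarrow> 'v \<Rightarrow> 'v \<Rightarrow> nat" where
  "depth T r v = length (THE p. pre_digraph.apath (with_proj T) r p v)"

definition level :: "'v pair_pre_digraph \<Rightarrow> 'v \<Rightarrow> nat \<Rightarrow> 'v set" where
  "level T r n = {v \<in> pverts T. depth T r v = n}"

definition level_mean ::
  "'v pair_pre_digraph \<Rightarrow> 'v \<Rightarrow> real \<Rightarrow> nat \<Rightarrow> ('v \<Rightarrow> complex) \<Rightarrow> real" where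
  "level_mean T r p n f =
     (1 / real (card (level T r n)) * (\<Sum>v\<in>level T r n. norm (f v) powr p)) powr (1 / p)"

definition Tp_norm ::
  "'v pair_pre_digraph \<Rightarrow> 'v \<Rightarrow> real \<Rightarrow> ('v \<Rightarrow> complex) \<Rightarrow> real" where
  "Tp_norm T r p f = (SUP n. level_mean T r p n f)"

text \<open>
  A function on the vertex set is represented by its extension by zero to the whole type; in this
  way pointwise operations and equality of functions are those of the type.
\<close>

definition Tp_space ::
  "'v pair_pre_digraph \<Rightarrow> 'v \<Rightarrow> real \<Rightarrow> ('v \<Rightarrow> complex) set" where
  "Tp_space T r p =
     {f. (\<forall>v. v \<notin> pverts T \<longrightarrow> f v = 0) \<and> bdd_above (range (\<lambda>n. level_mean T r p n f))}"

definition bounded_operator ::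
  "'v pair_pre_digraph \<Rightarrow> 'v \<Rightarrow> real \<Rightarrow> real \<Rightarrow> (('v \<Rightarrow> complex) \<Rightarrow> ('v \<Rightarrow> complex)) \<Rightarrow> bool" where
  "bounded_operator T r p q A \<longleftrightarrow>
     (\<forall>f\<in>Tp_space T r p. A f \<in> Tp_space T r q) \<and>
     (\<forall>f\<in>Tp_space T r p. \<forall>g\<in>Tp_space T r p.
        A (\<lambda>v. f v + g v) = (\<lambda>v. A f v + A g v)) \<and>
     (\<forall>c. \<forall>f\<in>Tp_space T r p. A (\<lambda>v. c * f v) = (\<lambda>v. c * A f v)) \<and>
     bdd_above {Tp_norm T r q (A f) / Tp_norm T r p f | f.
        f \<in> Tp_space T r p \<and> f \<noteq> (\<lambda>v. 0)}"

definition mult_operator :: "('v \<Rightarrow> complex) \<Rightarrow> ('v \<Rightarrow> complex) \<Rightarrow> ('v \<Rightarrow> complex)" where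
  "mult_operator \<psi> f = (\<lambda>v. \<psi> v * f v)"

definition invertible_operator ::
  "'v pair_pre_digraph \<Rightarrow> 'v \<Rightarrow> real \<Rightarrow> real \<Rightarrow> (('v \<Rightarrow> complex) \<Rightarrow> ('v \<Rightarrow> complex)) \<Rightarrow> bool" where
  "invertible_operator T r p q A \<longleftrightarrow>
     bounded_operator T r p q A \<and>
     (\<exists>B. bounded_operator T r q p B \<and>
        (\<forall>f\<in>Tp_space T r p. B (A f) = f) \<and>
        (\<forall>g\<in>Tp_space T r q. A (B g) = g))"

end

theory Submission
  imports Defs
begin

text \<open>
  Let $c = c_n$ and $s = 1/q - 1/p$. Testing $M_\psi$ and its inverse on the indicator of a single
  vertex $v$ of level $n$ shows that $|\psi(v)|$ is comparable to $c^s$, hence so is the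
  $q$-mean of $\psi$ on level $n$. Testing on the indicator of the whole level shows that
  this mean is comparable to $1$. So $c^s$ is bounded above and below uniformly in $n$, which
  for $s \neq 0$ bounds $c$.
\<close>

lemma level_mean_nonneg: "0 \<le> level_mean T r p n f"
  by (simp add: level_mean_def)

lemma level_mean_mono:
  assumes "0 < p" "\<And>v. v \<in> level T r n \<Longrightarrow> norm (f v) \<le> norm (g v)"
  shows "level_mean T r p n f \<le> level_mean T r p n g"
  unfolding level_mean_def using assms
  by (intro powr_mono2 mult_left_mono sum_mono) (auto intro!: sum_nonneg divide_nonneg_nonneg)

lemma level_mean_cong_norm:
  assumes "\<And>v. v \<in> level T r n \<Longrightarrow> norm (f v) = norm (g v)"
  shows "level_mean T r p n f = level_mean T r p n g"
  unfolding level_mean_def using assms by simp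

lemma level_mean_eq_0:
  assumes "\<And>v. v \<in> level T r n \<Longrightarrow> f v = 0"
  shows "level_mean T r p n f = 0"
  unfolding level_mean_def using assms by simp

lemma level_mean_const:
  assumes "0 < p" "0 < card (level T r n)"
  shows "level_mean T r p n (\<lambda>v. z) = norm z"
  using assms by (simp add: level_mean_def powr_powr)

text \<open>Only one term of the sum survives, so the normalising factor \<open>1 / card\<close> is
  left under the root. This is the only place where the norm of a test function depends on the
  exponent, and it produces the powers of the level size below.\<close>

lemma level_mean_single:
  assumes "0 < p" "finite (level T r n)" "w \<in> level T r n"
  shows "level_mean T r p n (\<lambda>v. if v = w then z else 0)
    = norm z * real (card (level T r n)) powr (- 1 / p)"
proof -
  have "(\<Sum>v\<in>level T r n. norm (if v = w then z else 0) powr p) =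
      (\<Sum>v\<in>level T r n. if v = w then norm z powr p else 0)"
    by (intro sum.cong) auto
  also have "\<dots> = norm z powr p"
    using assms by simp
  finally show ?thesis
    using assms(1)
    by (simp add: level_mean_def powr_divide powr_powr powr_minus_divide)
qed

text \<open>Off level \<open>n\<close> all means vanish and means are nonnegative, so the supremum
  is attained at \<open>n\<close>. Since this holds for every exponent, the norms of a test function
  and of its image both reduce to one mean.\<close>

lemma level_supported:
  assumes "\<And>v. v \<notin> level T r n \<Longrightarrow> f v = 0"
  shows Tp_space_level_supported: "f \<in> Tp_space T r p"
    and Tp_norm_level_supported: "Tp_norm T r p f = level_mean T r p n f"
proof -
  have le: "level_mean T r p m f \<le> level_mean T r p n f" for m
  proof (cases "m = n")
    case False
    then have "level_mean T r p m f = 0"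
      by (intro level_mean_eq_0 assms) (auto simp: level_def)
    then show ?thesis
      by (simp add: level_mean_nonneg)
  qed simp
  have "f v = 0" if "v \<notin> pverts T" for v
    using that by (intro assms) (auto simp: level_def)
  then show "f \<in> Tp_space T r p"
    using le by (auto simp: Tp_space_def intro!: bdd_aboveI2)
  show "Tp_norm T r p f = level_mean T r p n f"
    unfolding Tp_norm_def using le by (intro cSup_eq_maximum) auto
qed

lemma Tp_norm_0: "Tp_norm T r p (\<lambda>v. 0) = 0"
  by (simp add: Tp_norm_def level_mean_eq_0)

lemma level_mean_le_Tp_norm:
  assumes "f \<in> Tp_space T r p"
  shows "level_mean T r p n f \<le> Tp_norm T r p f"
  unfolding Tp_norm_def using assms by (intro cSUP_upper) (auto simp: Tp_space_def)

lemma Tp_norm_nonneg: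
  assumes "f \<in> Tp_space T r p"
  shows "0 \<le> Tp_norm T r p f"
  using level_mean_nonneg level_mean_le_Tp_norm[OF assms] by (rule order_trans)

text \<open>A zero norm forces every level mean to vanish, hence each finite sum of nonnegative
  terms and each of its terms. This keeps the denominators in \<open>bounded_operator\<close>
  positive.\<close>

lemma Tp_norm_eq_0D:
  assumes fin: "\<And>n. finite (level T r n)"
    and f: "f \<in> Tp_space T r p" and 0: "Tp_norm T r p f = 0"
  shows "f = (\<lambda>v. 0)"
proof
  fix v
  show "f v = 0"
  proof (cases "v \<in> pverts T")
    case True
    define n where "n = depth T r v"
    have v: "v \<in> level T r n"
      using True by (simp add: level_def n_def)
    then have "card (level T r n) \<noteq> 0"
      using fin[of n] by auto
    moreover have "level_mean T r p n f = 0"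
      using level_mean_le_Tp_norm[OF f, of n] level_mean_nonneg[of T r p n f] 0 by simp
    ultimately have "(\<Sum>v\<in>level T r n. norm (f v) powr p) = 0"
      by (simp add: level_mean_def)
    then show ?thesis
      using v fin[of n] by (subst (asm) sum_nonneg_eq_0_iff) auto
  qed (use f in \<open>auto simp: Tp_space_def\<close>)
qed

text \<open>Clearing the denominator turns the bounded quotients into a linear estimate, extended to
  the zero function by homogeneity.\<close>

lemma bounded_operatorE:
  assumes fin: "\<And>n. finite (level T r n)" and A: "bounded_operator T r p q A"
  obtains K where "0 < K" "\<And>f. f \<in> Tp_space T r p \<Longrightarrow> Tp_norm T r q (A f) \<le> K * Tp_norm T r p f"
proof -
  have "bdd_above {Tp_norm T r q (A f) / Tp_norm T r p f | f. f \<in> Tp_space T r p \<and> f \<noteq> (\<lambda>v. 0)}"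
    using A by (simp add: bounded_operator_def)
  then obtain K where K: "Tp_norm T r q (A f) / Tp_norm T r p f \<le> K"
    if "f \<in> Tp_space T r p" "f \<noteq> (\<lambda>v. 0)" for f
    by (auto elim!: bdd_above.E)
  \<comment> \<open>The maximum with 1 makes the constant positive, as later divisions
    require.\<close>
  have "Tp_norm T r q (A f) \<le> max K 1 * Tp_norm T r p f" if f: "f \<in> Tp_space T r p" for f
  proof (cases "f = (\<lambda>v. 0)")
    case True
    \<comment> \<open>Scaling by the scalar 0 shows that \<open>A\<close> sends the zero function to
      itself.\<close>
    have "A (\<lambda>v. 0 * f v) = (\<lambda>v. 0 * A f v)"
      using A f by (simp only: bounded_operator_def)
    then show ?thesis
      using True by (simp add: Tp_norm_0)
  next
    case False
    then have pos: "0 < Tp_norm T r p f"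
      using Tp_norm_eq_0D[OF fin f] Tp_norm_nonneg[OF f] by fastforce
    have "Tp_norm T r q (A f) / Tp_norm T r p f \<le> max K 1"
      using K[OF f False] by simp
    then show ?thesis
      using pos by (simp add: pos_divide_le_eq)
  qed
  then show ?thesis
    by (intro that[of "max K 1"]) auto
qed

lemma card_level_powr_bounded:
  assumes n: "finite (level T r n)" "level T r n \<noteq> {}" and pq: "0 < p" "0 < q" and KL: "0 < K" "0 < L"
    and upper: "\<And>f. f \<in> Tp_space T r p \<Longrightarrow>
      Tp_norm T r q (mult_operator \<psi> f) \<le> K * Tp_norm T r p f"
    and lower: "\<And>f. f \<in> Tp_space T r p \<Longrightarrow>
      Tp_norm T r p f \<le> L * Tp_norm T r q (mult_operator \<psi> f)"
  shows "real (card (level T r n)) powr (1 / q - 1 / p) \<le> K * L"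
    and "real (card (level T r n)) powr (1 / p - 1 / q) \<le> K * L"
proof -
  define c where "c = real (card (level T r n))"
  \<comment> \<open>The ratio of the \<open>p\<close>-norm to the \<open>q\<close>-norm of the
    indicator of one vertex of level \<open>n\<close>.\<close>
  define x where "x = c powr (1 / q - 1 / p)"
  have card: "0 < card (level T r n)"
    using n by (simp add: card_gt_0_iff)
  then have c: "0 < c"
    by (simp add: c_def)
  then have x: "0 < x"
    by (simp add: x_def)
  have shift: "c powr (- 1 / p) = x * c powr (- 1 / q)"
    by (simp add: x_def flip: powr_add)
  have \<psi>: "norm (\<psi> w) \<le> K * x" "x / L \<le> norm (\<psi> w)" if w: "w \<in> level T r n" for w
  proof -
    let ?f = "\<lambda>v. if v = w then 1 else 0 :: complex"
    have M: "mult_operator \<psi> ?f = (\<lambda>v. if v = w then \<psi> w else 0)"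
      by (auto simp: mult_operator_def)
    have f: "?f \<in> Tp_space T r p"
      using w by (intro Tp_space_level_supported[where n = n]) auto
    have "Tp_norm T r p ?f = level_mean T r p n ?f"
      using w by (intro Tp_norm_level_supported) auto
    then have 1: "Tp_norm T r p ?f = x * c powr (- 1 / q)"
      unfolding level_mean_single[OF pq(1) n(1) w] c_def[symmetric] shift by simp
    have "Tp_norm T r q (mult_operator \<psi> ?f) = level_mean T r q n (mult_operator \<psi> ?f)"
      using w by (intro Tp_norm_level_supported) (auto simp: mult_operator_def)
    then have 2: "Tp_norm T r q (mult_operator \<psi> ?f) = norm (\<psi> w) * c powr (- 1 / q)"
      unfolding M level_mean_single[OF pq(2) n(1) w] c_def[symmetric] .
    \<comment> \<open>Both estimates carry this positive factor, which cancels and leaves bounds on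
      \<open>norm (\<psi> w)\<close> independent of \<open>w\<close>.\<close>
    have "0 < c powr (- 1 / q)"
      using c by simp
    moreover have "norm (\<psi> w) * c powr (- 1 / q) \<le> (K * x) * c powr (- 1 / q)"
      using upper[OF f] unfolding 1 2 by (simp only: mult.assoc)
    moreover have "x * c powr (- 1 / q) \<le> (L * norm (\<psi> w)) * c powr (- 1 / q)"
      using lower[OF f] unfolding 1 2 by (simp only: mult.assoc)
    ultimately have "norm (\<psi> w) \<le> K * x" "x \<le> L * norm (\<psi> w)"
      by (auto dest: mult_right_le_imp_le)
    then show "norm (\<psi> w) \<le> K * x" "x / L \<le> norm (\<psi> w)"
      using KL by (auto simp: pos_divide_le_eq mult.commute)
  qed
  \<comment> \<open>The indicator of the level has norm 1 whatever the exponent, so no power of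
    \<open>c\<close> enters this second test.\<close>
  let ?g = "\<lambda>v. if v \<in> level T r n then 1 else 0 :: complex"
  define m where "m = level_mean T r q n \<psi>"
  have g: "?g \<in> Tp_space T r p"
    by (intro Tp_space_level_supported[where n = n]) auto
  have "Tp_norm T r p ?g = level_mean T r p n ?g"
    by (intro Tp_norm_level_supported) auto
  also have "\<dots> = level_mean T r p n (\<lambda>v. 1)"
    by (intro level_mean_cong_norm) auto
  also have "\<dots> = 1"
    using pq card by (simp add: level_mean_const)
  finally have 1: "Tp_norm T r p ?g = 1" .
  have "Tp_norm T r q (mult_operator \<psi> ?g) = level_mean T r q n (mult_operator \<psi> ?g)"
    by (intro Tp_norm_level_supported) (auto simp: mult_operator_def)
  also have "\<dots> = m"
    unfolding m_def by (intro level_mean_cong_norm) (auto simp: mult_operator_def)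
  finally have 2: "Tp_norm T r q (mult_operator \<psi> ?g) = m" .
  have m: "m \<le> K" "1 \<le> L * m"
    using upper[OF g] lower[OF g] unfolding 1 2 by auto
  \<comment> \<open>The bounds on \<open>\<psi>\<close> are uniform over the level, so comparison
    with constant functions transfers them to the mean.\<close>
  have "m \<le> level_mean T r q n (\<lambda>v. of_real (K * x))"
    unfolding m_def using \<psi>(1) KL x pq
    by (intro level_mean_mono) (auto simp: norm_mult)
  also have "\<dots> = K * x"
    using pq card KL x by (simp add: level_mean_const norm_mult)
  finally have m_le: "m \<le> K * x" .
  have "x / L = level_mean T r q n (\<lambda>v. of_real (x / L))"
    using pq card KL x by (simp add: level_mean_const norm_divide)
  also have "\<dots> \<le> m"
    unfolding m_def using \<psi>(2) KL x pq
    by (intro level_mean_mono) (auto simp: norm_divide)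
  finally have m_ge: "x / L \<le> m" .
  have "x / L \<le> K"
    using m_ge m(1) by simp
  then show "real (card (level T r n)) powr (1 / q - 1 / p) \<le> K * L"
    unfolding c_def[symmetric] x_def[symmetric] using KL by (simp add: pos_divide_le_eq)
  \<comment> \<open>The upper bound on \<open>x\<close> came from
    \<open>x / L \<le> m \<le> K\<close>; the lower one comes from \<open>1 \<le> L * m\<close> and
    \<open>m \<le> K * x\<close>.\<close>
  have "1 \<le> L * (K * x)"
    using m(2) m_le KL by (meson mult_left_mono less_imp_le order_trans)
  then have "1 / x \<le> K * L"
    using x by (simp add: pos_divide_le_eq mult_ac)
  moreover have "c powr (1 / p - 1 / q) = 1 / x"
    unfolding x_def by (simp flip: powr_minus_divide)
  ultimately show "real (card (level T r n)) powr (1 / p - 1 / q) \<le> K * L"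
    unfolding c_def[symmetric] by simp
qed

theorem theorem13:
  fixes T :: "'v pair_pre_digraph" and r :: 'v and p q :: real
  assumes "rooted_tree T r"
    and "infinite (pverts T)"
    and "\<And>n. finite (level T r n)"
    and "\<not> bdd_above (range (\<lambda>n. card (level T r n)))"
    and "0 < p" and "0 < q" and "p \<noteq> q"
  shows "\<nexists>\<psi> :: 'v \<Rightarrow> complex. invertible_operator T r p q (mult_operator \<psi>)"
proof
  assume "\<exists>\<psi> :: 'v \<Rightarrow> complex. invertible_operator T r p q (mult_operator \<psi>)"
  then obtain \<psi> :: "'v \<Rightarrow> complex" and B where
      M: "bounded_operator T r p q (mult_operator \<psi>)" and B: "bounded_operator T r q p B"
      and BM: "\<And>f. f \<in> Tp_space T r p \<Longrightarrow> B (mult_operator \<psi> f) = f"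
    unfolding invertible_operator_def by blast
  obtain K where K: "0 < K" and upper: "\<And>f. f \<in> Tp_space T r p \<Longrightarrow>
      Tp_norm T r q (mult_operator \<psi> f) \<le> K * Tp_norm T r p f"
    using bounded_operatorE[OF assms(3) M] by blast
  obtain L where L: "0 < L" and B_le: "\<And>g. g \<in> Tp_space T r q \<Longrightarrow>
      Tp_norm T r p (B g) \<le> L * Tp_norm T r q g"
    using bounded_operatorE[OF assms(3) B] by blast
  \<comment> \<open>As \<open>B\<close> undoes multiplication by \<open>\<psi>\<close>, its
    boundedness says that \<open>mult_operator \<psi>\<close> is bounded below.\<close>
  have lower: "Tp_norm T r p f \<le> L * Tp_norm T r q (mult_operator \<psi> f)"
    if "f \<in> Tp_space T r p" for f
  proof -
    have "mult_operator \<psi> f \<in> Tp_space T r q"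
      using M that by (simp add: bounded_operator_def)
    from B_le[OF this] show ?thesis
      by (simp add: BM[OF that])
  qed
  \<comment> \<open>The absolute value treats \<open>p < q\<close> and \<open>q < p\<close>
    together; \<open>s\<close> is positive because \<open>p\<close> and \<open>q\<close>
    differ.\<close>
  define s where "s = \<bar>1 / q - 1 / p\<bar>"
  have s: "0 < s"
    using assms(5-7) by (simp add: s_def)
  \<comment> \<open>Chosen so that \<open>b powr s = K * L\<close>.\<close>
  define b where "b = (K * L) powr (1 / s)"
  have "real (card (level T r n)) \<le> b" for n
  proof (cases "level T r n = {}")
    case False
    note bound = card_level_powr_bounded[OF assms(3) False assms(5,6) K L upper lower]
    have "real (card (level T r n)) powr s \<le> K * L"
      \<comment> \<open>The sign of \<open>1 / q - 1 / p\<close> decides which of the two bounds has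
        exponent \<open>s\<close>.\<close>
      using bound by (cases "1 / q \<ge> 1 / p") (auto simp: s_def abs_if)
    then have "(real (card (level T r n)) powr s) powr (1 / s) \<le> b"
      unfolding b_def using s by (intro powr_mono2) auto
    then show ?thesis
      using s by (simp add: powr_powr)
  qed (simp add: b_def)
  then have "card (level T r n) \<le> nat \<lfloor>b\<rfloor>" for n
    by (simp add: le_nat_floor)
  then have "bdd_above (range (\<lambda>n. card (level T r n)))"
    by (rule bdd_aboveI2)
  with assms(4) show False
    by contradiction
qed

end
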